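(* Let $\varepsilon>0$, $\gamma>0$, $\tau>0$, $A,B\ge 0$, and suppose $f=F'$ satisfies $\max_{\phi\in\mathbf R}|f'(\phi)|\le L$ with a constant $L\ge 0$. Let $(\phi^n)_{n\ge 0}$ be a solution, with given $\phi^0,\phi^1$, of the SL-CN scheme, i.e. for $n\ge 1$ $$\frac{\phi^{n+1}-\phi^{n}}{\tau}=\gamma\Delta \mu^{n+\frac12},$$ $$\mu^{n+\frac12}=-\varepsilon\Delta\Big(\frac{\phi^{n+1}+\phi^n}{2}\Big)+\frac1\varepsilon f\Big(\frac32\phi^n-\frac12\phi^{n-1}\Big)-A\tau\Delta\delta_t\phi^{n+1}+B\,\delta_{tt}\phi^{n+1}.$$ If $$A\ge \frac{L^2}{16\varepsilon^2}\gamma,\qquad B\ge\frac{L}{2\varepsilon},$$ then for all $n\ge 1$ $$E_{CN}^{n+1}\le E_{CN}^{n}-\Big(2\sqrt{\frac{A}{\gamma}}-\frac{L}{2\varepsilon}\Big)\|\delta_t\phi^{n+1}\|^2-\Big(\frac B2-\frac{L}{4\varepsilon}\Big)\|\delta_{tt}\phi^{n+1}\|^2,$$ where $$E_{CN}^{n+1}=E(\phi^{n+1})+\Big(\frac{L}{4\varepsilon}+\frac B2\Big)\|\delta_t\phi^{n+1}\|^2 .$$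
   Context: $\Omega\subset\mathbf R^d$, $d=2,3$, is a bounded domain with locally Lipschitz boundary and outward normal $n$; $\|\cdot\|$ is the $L^2(\Omega)$ norm. The scheme is a time semi-discretization (space is continuous) of the Cahn-Hilliard equation $\phi_t=\gamma\Delta\mu$, $\mu=-\varepsilon\Delta\phi+\frac1\varepsilon f(\phi)$ with homogeneous Neumann boundary conditions $\partial_n\phi=\partial_n\mu=0$ on $\partial\Omega$; all functions $\phi^n$ and $\mu^{n+\frac12}$ are understood to satisfy these homogeneous Neumann conditions. $F$ is the energy potential and $f=F'$. Notation: $\delta_t\phi^{n+1}=\phi^{n+1}-\phi^n$, $\delta_{tt}\phi^{n+1}=\phi^{n+1}-2\phi^n+\phi^{n-1}$. The energy is $$E(\phi)=\int_\Omega\Big(\frac\varepsilon2|\nabla\phi|^2+\frac1\varepsilon F(\phi)\Big)dx .$$ *)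

theory Defs
  imports "HOL-Analysis.Analysis"
begin

text \<open>Near each boundary point, \<open>\<Omega>\<close> is the region strictly above the graph of a Lipschitz function,
  in some orthonormal coordinate system with vertical axis \<open>e\<close>. The graph function \<open>h\<close> is evaluated
  at the orthogonal projection of \<open>y\<close> onto the hyperplane orthogonal to \<open>e\<close>.\<close>

definition locally_lipschitz_boundary :: "'a::euclidean_space set \<Rightarrow> bool" where
  "locally_lipschitz_boundary \<Omega> \<longleftrightarrow>
    (\<forall>x\<in>frontier \<Omega>. \<exists>r>0. \<exists>e h C. norm e = 1 \<and> C-lipschitz_on {y. y \<bullet> e = 0} h \<and>
       \<Omega> \<inter> ball x r = {y \<in> ball x r. h (y - (y \<bullet> e) *\<^sub>R e) < y \<bullet> e})"

definition bounded_lipschitz_domain :: "'a::euclidean_space set \<Rightarrow> bool" where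
  "bounded_lipschitz_domain \<Omega> \<longleftrightarrow>
     open \<Omega> \<and> connected \<Omega> \<and> \<Omega> \<noteq> {} \<and> bounded \<Omega> \<and> locally_lipschitz_boundary \<Omega>"

text \<open>Elements of \<open>L\<^sup>2(\<Omega>)\<close> are represented by functions on the whole space of which only the
  restriction to \<open>\<Omega>\<close>, up to null sets, matters.\<close>

definition L2 :: "'a::euclidean_space set \<Rightarrow> ('a \<Rightarrow> 'b::euclidean_space) set" where
  "L2 \<Omega> = {u. u \<in> borel_measurable (lebesgue_on \<Omega>) \<and>
               integrable (lebesgue_on \<Omega>) (\<lambda>x. (norm (u x))\<^sup>2)}"

definition L2_norm :: "'a::euclidean_space set \<Rightarrow> ('a \<Rightarrow> 'b::euclidean_space) \<Rightarrow> real" where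
  "L2_norm \<Omega> u = sqrt (\<integral>x. (norm (u x))\<^sup>2 \<partial>lebesgue_on \<Omega>)"

definition partial :: "'a::euclidean_space \<Rightarrow> ('a \<Rightarrow> real) \<Rightarrow> 'a \<Rightarrow> real" where
  "partial b f x = frechet_derivative f (at x) b"

fun Ck :: "nat \<Rightarrow> ('a::euclidean_space \<Rightarrow> real) \<Rightarrow> bool" where
  "Ck 0 f \<longleftrightarrow> continuous_on UNIV f"
| "Ck (Suc k) f \<longleftrightarrow> (\<forall>x. f differentiable (at x)) \<and> (\<forall>b\<in>Basis. Ck k (partial b f))"

text \<open>\<open>C\<^sub>c\<^sup>\<infinity>(\<Omega>)\<close>, its elements being extended by zero to the whole space.\<close>

definition test_functions :: "'a::euclidean_space set \<Rightarrow> ('a \<Rightarrow> real) set" where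
  "test_functions \<Omega> = {\<psi>. (\<forall>k. Ck k \<psi>) \<and> compact (closure {x. \<psi> x \<noteq> 0}) \<and>
                          closure {x. \<psi> x \<noteq> 0} \<subseteq> \<Omega>}"

definition has_weak_gradient ::
    "'a::euclidean_space set \<Rightarrow> ('a \<Rightarrow> real) \<Rightarrow> ('a \<Rightarrow> 'a) \<Rightarrow> bool" where
  "has_weak_gradient \<Omega> u g \<longleftrightarrow> g \<in> L2 \<Omega> \<and>
     (\<forall>\<psi>\<in>test_functions \<Omega>. \<forall>b\<in>Basis.
        (\<integral>x. u x * partial b \<psi> x \<partial>lebesgue_on \<Omega>) = - (\<integral>x. (g x \<bullet> b) * \<psi> x \<partial>lebesgue_on \<Omega>))"

definition H1 :: "'a::euclidean_space set \<Rightarrow> ('a \<Rightarrow> real) set" where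
  "H1 \<Omega> = {u \<in> L2 \<Omega>. \<exists>g. has_weak_gradient \<Omega> u g}"

text \<open>For \<open>u \<in> H\<^sup>1(\<Omega>)\<close>, an arbitrary representative of the (almost everywhere unique) weak gradient;
  similarly below for the weak Laplacian.\<close>

definition wgrad :: "'a::euclidean_space set \<Rightarrow> ('a \<Rightarrow> real) \<Rightarrow> 'a \<Rightarrow> 'a" where
  "wgrad \<Omega> u = (SOME g. has_weak_gradient \<Omega> u g)"

definition has_weak_laplacian ::
    "'a::euclidean_space set \<Rightarrow> ('a \<Rightarrow> real) \<Rightarrow> ('a \<Rightarrow> real) \<Rightarrow> bool" where
  "has_weak_laplacian \<Omega> u w \<longleftrightarrow> w \<in> L2 \<Omega> \<and>
     (\<forall>\<psi>\<in>test_functions \<Omega>.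
        (\<integral>x. u x * (\<Sum>b\<in>Basis. partial b (partial b \<psi>) x) \<partial>lebesgue_on \<Omega>) =
        (\<integral>x. w x * \<psi> x \<partial>lebesgue_on \<Omega>))"

definition wlap :: "'a::euclidean_space set \<Rightarrow> ('a \<Rightarrow> real) \<Rightarrow> 'a \<Rightarrow> real" where
  "wlap \<Omega> u = (SOME w. has_weak_laplacian \<Omega> u w)"

text \<open>On a Lipschitz domain, the normal derivative of \<open>u \<in> H\<^sup>1(\<Omega>)\<close> with \<open>\<Delta>u \<in> L\<^sup>2(\<Omega>)\<close> is by definition
  the functional on traces \<open>v \<mapsto> \<integral>\<^sub>\<Omega> (\<nabla>u \<cdot> \<nabla>v + v \<Delta>u)\<close> for \<open>v \<in> H\<^sup>1(\<Omega>)\<close>, an element of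
  \<open>H\<^sup>-\<^sup>1\<^sup>/\<^sup>2(\<partial>\<Omega>)\<close>.\<close>

definition normal_derivative ::
    "'a::euclidean_space set \<Rightarrow> ('a \<Rightarrow> real) \<Rightarrow> ('a \<Rightarrow> real) \<Rightarrow> real" where
  "normal_derivative \<Omega> u v =
     (\<integral>x. wgrad \<Omega> u x \<bullet> wgrad \<Omega> v x + v x * wlap \<Omega> u x \<partial>lebesgue_on \<Omega>)"

definition neumann_functions :: "'a::euclidean_space set \<Rightarrow> ('a \<Rightarrow> real) set" where
  "neumann_functions \<Omega> = {u \<in> H1 \<Omega>. (\<exists>w. has_weak_laplacian \<Omega> u w) \<and>
                                    (\<forall>v\<in>H1 \<Omega>. normal_derivative \<Omega> u v = 0)}"

definition dt :: "(nat \<Rightarrow> 'a \<Rightarrow> real) \<Rightarrow> nat \<Rightarrow> 'a \<Rightarrow> real" where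
  "dt \<phi> n x = \<phi> n x - \<phi> (n - 1) x"

definition dtt :: "(nat \<Rightarrow> 'a \<Rightarrow> real) \<Rightarrow> nat \<Rightarrow> 'a \<Rightarrow> real" where
  "dtt \<phi> n x = \<phi> n x - 2 * \<phi> (n - 1) x + \<phi> (n - 2) x"

text \<open>\<open>\<mu> n\<close> stands for \<open>\<mu>\<close> at the half step \<open>n + 1/2\<close>.\<close>

definition SL_CN_solution ::
    "'a::euclidean_space set \<Rightarrow> real \<Rightarrow> real \<Rightarrow> real \<Rightarrow> real \<Rightarrow> real \<Rightarrow> (real \<Rightarrow> real) \<Rightarrow>
     (nat \<Rightarrow> 'a \<Rightarrow> real) \<Rightarrow> (nat \<Rightarrow> 'a \<Rightarrow> real) \<Rightarrow> bool" where
  "SL_CN_solution \<Omega> \<epsilon> \<gamma> \<tau> A B f \<phi> \<mu> \<longleftrightarrow>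
     (\<forall>n. \<phi> n \<in> neumann_functions \<Omega>) \<and>
     (\<forall>n\<ge>1. \<mu> n \<in> neumann_functions \<Omega>) \<and>
     (\<forall>n\<ge>1. AE x in lebesgue_on \<Omega>.
        (\<phi> (n + 1) x - \<phi> n x) / \<tau> = \<gamma> * wlap \<Omega> (\<mu> n) x) \<and>
     (\<forall>n\<ge>1. AE x in lebesgue_on \<Omega>.
        \<mu> n x = - \<epsilon> * wlap \<Omega> (\<lambda>y. (\<phi> (n + 1) y + \<phi> n y) / 2) x
                + 1 / \<epsilon> * f (3 / 2 * \<phi> n x - 1 / 2 * \<phi> (n - 1) x)
                - A * \<tau> * wlap \<Omega> (dt \<phi> (n + 1)) x
                + B * dtt \<phi> (n + 1) x)"

definition energy ::
    "'a::euclidean_space set \<Rightarrow> real \<Rightarrow> (real \<Rightarrow> real) \<Rightarrow> ('a \<Rightarrow> real) \<Rightarrow> real" where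
  "energy \<Omega> \<epsilon> F u =
     (\<integral>x. \<epsilon> / 2 * (norm (wgrad \<Omega> u x))\<^sup>2 + 1 / \<epsilon> * F (u x) \<partial>lebesgue_on \<Omega>)"

definition E_CN ::
    "'a::euclidean_space set \<Rightarrow> real \<Rightarrow> (real \<Rightarrow> real) \<Rightarrow> real \<Rightarrow> real \<Rightarrow>
     (nat \<Rightarrow> 'a \<Rightarrow> real) \<Rightarrow> nat \<Rightarrow> real" where
  "E_CN \<Omega> \<epsilon> F L B \<phi> n =
     energy \<Omega> \<epsilon> F (\<phi> n) + (L / (4 * \<epsilon>) + B / 2) * (L2_norm \<Omega> (dt \<phi> n))\<^sup>2"

end

theory Submission
  imports Defs
begin

text \<open>
  The stability estimate is an energy argument for a single time step. Write \<open>p\<close>, \<open>q\<close>, \<open>r\<close> for three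
  consecutive levels (newest first), \<open>m\<close> for the chemical potential, \<open>d = p - q\<close>, \<open>d' = q - r\<close> and
  \<open>s = d - d'\<close>. Testing the second equation with \<open>d\<close> and inserting the first one gives an exact
  identity (\<open>tested_scheme\<close>): the dissipation \<open>- \<gamma> \<tau> \<parallel>\<nabla>m\<parallel>\<^sup>2\<close> equals the increment of the gradient
  energy, plus \<open>1 / \<epsilon> \<integral> f(h) d\<close> at the extrapolated value \<open>h\<close>, plus \<open>A \<tau> \<parallel>\<nabla>p - \<nabla>q\<parallel>\<^sup>2\<close>, plus
  \<open>B \<integral> s d = B / 2 (\<parallel>d\<parallel>\<^sup>2 - \<parallel>d'\<parallel>\<^sup>2 + \<parallel>s\<parallel>\<^sup>2)\<close>.

  Two inequalities finish the argument. Pointwise Taylor expansion about \<open>h\<close> replaces \<open>f(h) d\<close> by the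
  increment of \<open>F\<close>, at the price of \<open>L / 4 (d\<^sup>2 + d'\<^sup>2 + s\<^sup>2)\<close> (\<open>extrapolated_potential_increment\<close>).
  Since \<open>d = \<gamma> \<tau> \<Delta>m\<close>, Green's formula and Young's inequality bound \<open>2 \<surd>(A / \<gamma>) \<parallel>d\<parallel>\<^sup>2\<close> by the two
  dissipative terms \<open>\<gamma> \<tau> \<parallel>\<nabla>m\<parallel>\<^sup>2 + A \<tau> \<parallel>\<nabla>p - \<nabla>q\<parallel>\<^sup>2\<close> (\<open>interpolation_inequality\<close>).

  The analytic difficulty lies in the weak Laplacian. The scheme applies it to \<open>(p + q) / 2\<close> and to
  \<open>p - q\<close>, while Green's formula is available for \<open>p\<close> and \<open>q\<close>. As \<open>wlap\<close> is an arbitrary choice of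
  representative, its linearity (\<open>wlap_lincomb_AE\<close>) requires the fundamental lemma of the calculus of
  variations, hence enough smooth compactly supported functions; these are built from \<open>exp (- 1 / t)\<close>.
  Gradients are kept separate for each time level throughout, so that the same question does not arise
  for \<open>wgrad\<close>.
\<close>

section \<open>Smooth bumps on boxes\<close>

text \<open>The powers of \<open>1 / t\<close> are carried along so that the family is closed, up to linear combinations,
  under differentiation; the member \<open>m = 0\<close> is the classical smooth function that is flat at \<open>0\<close>.\<close>

definition exp_recip :: "nat \<Rightarrow> real \<Rightarrow> real" where
  "exp_recip m t = (if t > 0 then exp (- (1 / t)) / t ^ m else 0)"

lemma exp_recip_tendsto_0: "((\<lambda>t. exp_recip m t) \<longlongrightarrow> 0) (at 0)"
proof -
  have "((\<lambda>t::real. inverse t ^ m / exp (inverse t)) \<longlongrightarrow> 0) (at_right 0)"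
    by (rule filterlim_compose[OF tendsto_power_div_exp_0 filterlim_inverse_at_top_right])
  then have "(exp_recip m \<longlongrightarrow> 0) (at_right 0)"
    by (rule Lim_transform_eventually)
      (auto simp: eventually_at_filter exp_recip_def exp_minus field_simps)
  moreover have "(exp_recip m \<longlongrightarrow> 0) (at_left 0)"
    by (rule tendsto_eventually) (auto simp: eventually_at_filter exp_recip_def)
  ultimately show ?thesis by (simp add: filterlim_split_at)
qed

text \<open>Away from \<open>0\<close> this is the quotient rule. At \<open>0\<close> the difference quotient is the next member of the
  family, which tends to \<open>0\<close> because the exponential beats every power.\<close>

lemma exp_recip_deriv:
  "(exp_recip m has_real_derivative exp_recip (m + 2) t - m * exp_recip (m + 1) t) (at t)"
proof -
  consider "t > 0" | "t < 0" | "t = 0" by linarith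
  then show ?thesis
  proof cases
    case 1
    have "((\<lambda>t. exp (- (1 / t)) / t ^ m) has_real_derivative
        exp_recip (m + 2) t - m * exp_recip (m + 1) t) (at t)"
    proof (cases m)
      case 0
      then show ?thesis
        using 1 by (auto intro!: derivative_eq_intros simp: exp_recip_def field_simps power2_eq_square)
    next
      case (Suc j)
      have "((\<lambda>t. exp (- (1 / t))) has_real_derivative exp (- (1 / t)) / t\<^sup>2) (at t)"
        using 1 by (auto intro!: derivative_eq_intros simp: field_simps power2_eq_square)
      moreover have "((\<lambda>t. t ^ m) has_real_derivative m * t ^ j) (at t)"
        using DERIV_pow[of m t] Suc by simp
      ultimately have "((\<lambda>t. exp (- (1 / t)) / t ^ m) has_real_derivative
          (exp (- (1 / t)) / t\<^sup>2 * t ^ m - exp (- (1 / t)) * (m * t ^ j)) / (t ^ m * t ^ m)) (at t)"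
        using 1 by (intro DERIV_divide) auto
      then show ?thesis
        by (rule DERIV_cong) (use 1 Suc in \<open>simp add: exp_recip_def field_simps power2_eq_square\<close>)
    qed
    moreover have "eventually (\<lambda>s. exp (- (1 / s)) / s ^ m = exp_recip m s) (nhds t)"
      using eventually_nhds_in_open[of "{0<..}" t] 1
      by (auto simp: exp_recip_def elim!: eventually_mono)
    ultimately show ?thesis
      by (subst DERIV_cong_ev[OF refl _ refl, symmetric])
  next
    case 2
    have "eventually (\<lambda>s. 0 = exp_recip m s) (nhds t)"
      using eventually_nhds_in_open[of "{..<0}" t] 2
      by (auto simp: exp_recip_def elim!: eventually_mono)
    moreover have "((\<lambda>s. 0) has_real_derivative
        exp_recip (m + 2) t - m * exp_recip (m + 1) t) (at t)"
      using 2 by (simp add: exp_recip_def)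
    ultimately show ?thesis
      by (subst DERIV_cong_ev[OF refl _ refl, symmetric])
  next
    case 3
    have "exp_recip (m + 1) = (\<lambda>h. (exp_recip m (0 + h) - exp_recip m 0) / h)"
      by (auto simp: exp_recip_def fun_eq_iff)
    with exp_recip_tendsto_0[of "m + 1"]
    have "(\<lambda>h. (exp_recip m (0 + h) - exp_recip m 0) / h) \<midarrow>0\<rightarrow> 0" by simp
    moreover have "exp_recip (m + 2) t - m * exp_recip (m + 1) t = 0"
      using 3 by (simp add: exp_recip_def)
    ultimately show ?thesis
      unfolding DERIV_def 3 by (simp only:)
  qed
qed

lemma partial_eq:
  assumes "(f has_derivative f') (at x)"
  shows "partial b f x = f' b"
  using frechet_derivative_at[OF assms] by (simp add: partial_def)

lemma Ck_continuous:
  assumes "Ck k f"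
  shows "continuous_on UNIV f"
proof (cases k)
  case 0
  with assms show ?thesis by simp
next
  case (Suc j)
  with assms have "f differentiable (at x)" for x by simp
  then show ?thesis
    by (intro continuous_at_imp_continuous_on ballI differentiable_imp_continuous_within)
qed

lemma Ck_SucD: "Ck (Suc k) f \<Longrightarrow> Ck k f"
proof (induction k arbitrary: f)
  case 0
  then have "continuous_on UNIV f" by (rule Ck_continuous)
  then show ?case by simp
next
  case (Suc k)
  then show ?case by (metis Ck.simps(2))
qed

lemma Ck_const: "Ck k (\<lambda>x. c)"
proof (induction k arbitrary: c)
  case (Suc k)
  have "partial b (\<lambda>x. c) = (\<lambda>x. 0)" for b :: 'a
    by (simp add: partial_def fun_eq_iff)
  with Suc show ?case by simp
qed simp

lemma Ck_add: "Ck k f \<Longrightarrow> Ck k g \<Longrightarrow> Ck k (\<lambda>x. f x + g x)"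
proof (induction k arbitrary: f g)
  case 0
  then show ?case by (auto intro: continuous_intros)
next
  case (Suc k)
  have "partial b (\<lambda>x. f x + g x) = (\<lambda>x. partial b f x + partial b g x)" for b
  proof
    fix x
    from Suc.prems have "((\<lambda>x. f x + g x) has_derivative
        (\<lambda>h. frechet_derivative f (at x) h + frechet_derivative g (at x) h)) (at x)"
      by (intro has_derivative_add) (auto simp: frechet_derivative_works[symmetric])
    then show "partial b (\<lambda>x. f x + g x) x = partial b f x + partial b g x"
      by (simp only: partial_eq) (simp add: partial_def)
  qed
  with Suc show ?case by auto
qed

text \<open>In the Leibniz rule the factors themselves reappear next to partial derivatives of one order less, so
  the induction also uses that the classes are decreasing in the order.\<close>

lemma Ck_mult: "Ck k f \<Longrightarrow> Ck k g \<Longrightarrow> Ck k (\<lambda>x. f x * g x)"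
proof (induction k arbitrary: f g)
  case 0
  then show ?case by (auto intro: continuous_intros)
next
  case (Suc k)
  have "partial b (\<lambda>x. f x * g x) = (\<lambda>x. f x * partial b g x + partial b f x * g x)" for b
  proof
    fix x
    from Suc.prems have "((\<lambda>x. f x * g x) has_derivative
        (\<lambda>h. f x * frechet_derivative g (at x) h + frechet_derivative f (at x) h * g x)) (at x)"
      by (intro has_derivative_mult) (auto simp: frechet_derivative_works[symmetric])
    then show "partial b (\<lambda>x. f x * g x) x = f x * partial b g x + partial b f x * g x"
      by (simp only: partial_eq) (simp add: partial_def)
  qed
  moreover have "Ck k (\<lambda>x. f x * partial b g x + partial b f x * g x)" if "b \<in> Basis" for b
    using Suc.prems that by (intro Ck_add Suc.IH Ck_SucD[of k f] Ck_SucD[of k g]) auto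
  ultimately show ?case using Suc.prems by auto
qed

lemma Ck_prod: "finite I \<Longrightarrow> (\<And>i. i \<in> I \<Longrightarrow> Ck k (f i)) \<Longrightarrow> Ck k (\<lambda>x. \<Prod>i\<in>I. f i x)"
  by (induction I rule: finite_induct) (auto intro: Ck_const Ck_mult)

lemma Ck_exp_recip_affine: "Ck k (\<lambda>x. exp_recip m (c + x \<bullet> v))"
proof (induction k arbitrary: m)
  case 0
  have "continuous_on UNIV (exp_recip m)"
    by (intro continuous_at_imp_continuous_on ballI DERIV_isCont[OF exp_recip_deriv])
  then show ?case
    by (auto intro!: continuous_on_compose2[of UNIV "exp_recip m"] continuous_intros)
next
  case (Suc k)
  have D: "((\<lambda>x. exp_recip m (c + x \<bullet> v)) has_derivative
      (\<lambda>h. (exp_recip (m + 2) (c + x \<bullet> v) - m * exp_recip (m + 1) (c + x \<bullet> v)) * (h \<bullet> v))) (at x)"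
    for x :: 'a
    by (rule has_derivative_compose[OF _ exp_recip_deriv[unfolded has_field_derivative_def], THEN has_derivative_eq_rhs])
      (auto intro!: derivative_eq_intros)
  have "partial b (\<lambda>x. exp_recip m (c + x \<bullet> v)) = (\<lambda>x. (b \<bullet> v) * exp_recip (m + 2) (c + x \<bullet> v)
      + - (b \<bullet> v) * m * exp_recip (m + 1) (c + x \<bullet> v))" for b
    by (auto simp: partial_eq[OF D] fun_eq_iff algebra_simps)
  moreover have "Ck k (\<lambda>x. (b \<bullet> v) * exp_recip (m + 2) (c + x \<bullet> v)
      + - (b \<bullet> v) * m * exp_recip (m + 1) (c + x \<bullet> v))" for b
    by (intro Ck_add Ck_mult Ck_const Suc.IH)
  ultimately show ?case using D by (auto simp: differentiable_def)
qed

text \<open>A scaling trick replaces the usual construction of plateau functions: each factor is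
  \<open>exp (- 1 / (k t))\<close> for \<open>t > 0\<close>, so that the bump is the \<open>k\<close>-th root of a fixed one. For
  \<open>k \<ge> 1\<close> it vanishes exactly off the open box, and inside it increases to \<open>1\<close> as \<open>k\<close> grows.\<close>

definition box_bump :: "'a::euclidean_space \<Rightarrow> 'a \<Rightarrow> nat \<Rightarrow> 'a \<Rightarrow> real" where
  "box_bump a b k x = (\<Prod>i\<in>Basis. exp_recip 0 (real k * ((x - a) \<bullet> i)) * exp_recip 0 (real k * ((b - x) \<bullet> i)))"

lemma Ck_box_bump: "Ck n (box_bump a b k)"
proof -
  have "box_bump a b k = (\<lambda>x. \<Prod>i\<in>Basis. exp_recip 0 (- real k * (a \<bullet> i) + x \<bullet> (real k *\<^sub>R i))
      * exp_recip 0 (real k * (b \<bullet> i) + x \<bullet> (- real k *\<^sub>R i)))"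
    by (simp add: box_bump_def fun_eq_iff algebra_simps)
  then show ?thesis
    by (simp only:) (intro Ck_prod Ck_mult Ck_exp_recip_affine finite_Basis)
qed

lemma exp_recip_0_bounds: "0 \<le> exp_recip 0 t" "exp_recip 0 t \<le> 1"
  by (auto simp: exp_recip_def)

lemma box_bump_bounds: "0 \<le> box_bump a b k x" "box_bump a b k x \<le> 1"
  unfolding box_bump_def
  by (auto intro!: prod_nonneg prod_le_1 mult_le_one simp: exp_recip_0_bounds)

lemma box_bump_outside:
  assumes "x \<notin> box a b"
  shows "box_bump a b k x = 0"
proof -
  obtain i where i: "i \<in> Basis" "(x - a) \<bullet> i \<le> 0 \<or> (b - x) \<bullet> i \<le> 0"
    using assms by (auto simp: mem_box not_less algebra_simps)
  then have "exp_recip 0 (real k * ((x - a) \<bullet> i)) * exp_recip 0 (real k * ((b - x) \<bullet> i)) = 0"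
    by (auto simp: exp_recip_def zero_less_mult_iff)
  with i show ?thesis
    unfolding box_bump_def by (intro prod_zero) auto
qed

lemma box_bump_tendsto: "(\<lambda>k. box_bump a b k x) \<longlonglongrightarrow> indicator (box a b) x"
proof (cases "x \<in> box a b")
  case True
  have *: "(\<lambda>k. exp_recip 0 (real k * t)) \<longlonglongrightarrow> 1" if "t > 0" for t
  proof -
    have "(\<lambda>k. exp (- (1 / t / real k))) \<longlonglongrightarrow> exp (- 0)"
      by (intro tendsto_intros lim_const_over_n)
    then have "(\<lambda>k. exp (- (1 / t / real k))) \<longlonglongrightarrow> 1" by simp
    moreover have "eventually (\<lambda>k. exp (- (1 / t / real k)) = exp_recip 0 (real k * t)) sequentially"
      using eventually_gt_at_top[of "0::nat"]
      by (rule eventually_mono) (use that in \<open>simp add: exp_recip_def mult.commute\<close>)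
    ultimately show ?thesis by (rule Lim_transform_eventually)
  qed
  have "(\<lambda>k. box_bump a b k x) \<longlonglongrightarrow> (\<Prod>i\<in>(Basis::'a set). 1 * 1)"
    unfolding box_bump_def using True
    by (intro tendsto_prod tendsto_mult *) (auto simp: mem_box algebra_simps)
  with True show ?thesis by simp
qed (simp add: box_bump_outside)

lemma box_bump_test_function:
  assumes "cbox a b \<subseteq> \<Omega>"
  shows "box_bump a b k \<in> test_functions \<Omega>"
proof -
  have "{x. box_bump a b k x \<noteq> 0} \<subseteq> cbox a b"
    using box_bump_outside box_subset_cbox by blast
  then have "closure {x. box_bump a b k x \<noteq> 0} \<subseteq> cbox a b"
    by (simp add: closure_minimal closed_cbox)
  then show ?thesis
    using assms Ck_box_bump
    by (auto simp: test_functions_def compact_eq_bounded_closed intro: bounded_subset[OF bounded_cbox])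
qed

section \<open>The fundamental lemma of the calculus of variations\<close>

text \<open>The Borel sets over which \<open>w\<close> integrates to zero form a Dynkin system: the vanishing total integral
  gives complements, countable additivity of the integral gives disjoint unions. Boxes are stable
  under intersection and generate the Borel sets, and a density whose integral over every measurable
  set is zero vanishes.\<close>

lemma AE_lborel_eq_0_if_box_integrals_0:
  fixes w :: "'a::euclidean_space \<Rightarrow> real"
  assumes w: "integrable lborel w" and total: "(\<integral>x. w x \<partial>lborel) = 0"
    and box: "\<And>a b. (\<integral>x. indicator (box a b) x * w x \<partial>lborel) = 0"
  shows "AE x in lborel. w x = 0"
proof -
  have si: "set_integrable lborel A w" if "A \<in> sets borel" for A
    unfolding set_integrable_def using w that by (intro integrable_mult_indicator) simp_all
  have "set_lebesgue_integral lborel A w = 0" if A: "A \<in> sets borel" for A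
  proof -
    have "Int_stable (range (\<lambda>(a, b). box a b :: 'a set))"
      by (auto simp: Int_stable_def box_Int_box)
    moreover have "(range (\<lambda>(a, b). box a b)) \<subseteq> Pow (UNIV :: 'a set)"
      by auto
    moreover have "A \<in> sigma_sets UNIV (range (\<lambda>(a, b). box a b))"
      using A unfolding borel_eq_box by simp
    ultimately show ?thesis
    proof (induction rule: sigma_sets_induct_disjoint)
      case (basic A)
      then show ?case using box by (auto simp: set_lebesgue_integral_def)
    next
      case empty
      then show ?case by (simp add: set_lebesgue_integral_def)
    next
      case (compl A)
      then have [measurable]: "A \<in> sets borel"
        by (simp add: borel_eq_box)
      have "set_lebesgue_integral lborel ((UNIV - A) \<union> A) w =
          set_lebesgue_integral lborel (UNIV - A) w + set_lebesgue_integral lborel A w"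
        by (rule set_integral_Un) (auto intro!: si)
      with compl.IH total show ?case by (simp add: set_lebesgue_integral_def)
    next
      case (union F)
      then have F [measurable]: "\<And>i. F i \<in> sets borel"
        by (simp add: borel_eq_box subset_eq)
      have "set_lebesgue_integral lborel (\<Union>i. F i) w = (\<Sum>i. set_lebesgue_integral lborel (F i) w)"
        using union(1)
        by (intro lebesgue_integral_countable_add si) (auto simp: disjoint_family_on_def)
      then show ?case by (simp add: union.IH)
    qed
  qed
  then show ?thesis by (intro sigma_finite_measure.density_zero[OF sigma_finite_lborel w]) auto
qed

text \<open>A Lebesgue measurable function has a Borel representative, which reduces this to the Borel case.\<close>

lemma AE_lebesgue_eq_0_if_box_integrals_0:
  fixes w :: "'a::euclidean_space \<Rightarrow> real"
  assumes w: "integrable lebesgue w" and total: "(\<integral>x. w x \<partial>lebesgue) = 0"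
    and box: "\<And>a b. (\<integral>x. indicator (box a b) x * w x \<partial>lebesgue) = 0"
  shows "AE x in lebesgue. w x = 0"
proof -
  obtain v where v [measurable]: "v \<in> borel_measurable lborel" and wv: "AE x in lborel. w x = v x"
    using completion_ex_borel_measurable_real[OF borel_measurable_integrable[OF w]] by auto
  have wv': "AE x in lebesgue. w x = v x" using wv by (rule AE_completion)
  have v' [measurable]: "v \<in> borel_measurable lebesgue" using v by (rule measurable_completion)
  have [measurable]: "w \<in> borel_measurable lebesgue" using w by simp
  have "AE x in lborel. v x = 0"
  proof (rule AE_lborel_eq_0_if_box_integrals_0)
    have "integrable lebesgue v"
      using w wv' by (subst integrable_cong_AE[of _ _ w]) auto
    then show "integrable lborel v" by (simp add: integrable_completion)
    have "(\<integral>x. v x \<partial>lborel) = (\<integral>x. v x \<partial>lebesgue)"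
      by (simp add: integral_completion)
    also have "\<dots> = (\<integral>x. w x \<partial>lebesgue)" using wv' by (intro integral_cong_AE) auto
    finally show "(\<integral>x. v x \<partial>lborel) = 0" using total by simp
    fix a b :: 'a
    have "(\<integral>x. indicator (box a b) x * v x \<partial>lborel) = (\<integral>x. indicator (box a b) x * v x \<partial>lebesgue)"
      by (rule integral_completion[symmetric]) measurable
    also have "\<dots> = (\<integral>x. indicator (box a b) x * w x \<partial>lebesgue)"
      using wv' by (intro integral_cong_AE) (auto intro!: borel_measurable_times borel_measurable_indicator)
    finally show "(\<integral>x. indicator (box a b) x * v x \<partial>lborel) = 0" using box by simp
  qed
  with wv have "AE x in lborel. w x = 0" by eventually_elim simp
  then show ?thesis by (rule AE_completion)
qed

text \<open>Bumps on a box \<open>cbox a b\<close> inside \<open>\<Omega>\<close> are admissible test functions and converge boundedly to the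
  indicator of \<open>box a b\<close>, so \<open>w\<close> integrates to zero over it. Truncating \<open>w\<close> to a fixed \<open>box c d\<close> makes
  this true for all boxes of the space, since a box meets \<open>box c d\<close> in a box.\<close>

lemma AE_zero_on_box:
  fixes w :: "'a::euclidean_space \<Rightarrow> real"
  assumes w: "integrable (lebesgue_on \<Omega>) w" and \<Omega>: "open \<Omega>"
    and ortho: "\<And>\<psi>. \<psi> \<in> test_functions \<Omega> \<Longrightarrow> (\<integral>x. w x * \<psi> x \<partial>lebesgue_on \<Omega>) = 0"
    and sub: "cbox c d \<subseteq> \<Omega>"
  shows "AE x in lebesgue. x \<in> box c d \<longrightarrow> w x = 0"
proof -
  have \<Omega>' [measurable]: "\<Omega> \<in> sets lebesgue" using \<Omega> by simp
  have wm [measurable]: "w \<in> borel_measurable (lebesgue_on \<Omega>)" using w by simp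
  have box0: "(\<integral>x. w x * indicator (box a b) x \<partial>lebesgue_on \<Omega>) = 0" if ab: "cbox a b \<subseteq> \<Omega>" for a b
  proof -
    have "(\<lambda>k. \<integral>x. w x * box_bump a b k x \<partial>lebesgue_on \<Omega>)
        \<longlonglongrightarrow> (\<integral>x. w x * indicator (box a b) x \<partial>lebesgue_on \<Omega>)"
    proof (rule integral_dominated_convergence[where w = "\<lambda>x. norm (w x)"])
      show "(\<lambda>x. w x * box_bump a b k x) \<in> borel_measurable (lebesgue_on \<Omega>)" for k
      proof -
        have "box_bump a b k \<in> borel_measurable borel"
          by (intro borel_measurable_continuous_onI Ck_continuous Ck_box_bump)
        then have "box_bump a b k \<in> borel_measurable (lebesgue_on \<Omega>)"
          by (intro measurable_restrict_space1 measurable_completion) simp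
        then show ?thesis by measurable
      qed
      show "(\<lambda>x. w x * indicator (box a b) x) \<in> borel_measurable (lebesgue_on \<Omega>)"
        by (intro borel_measurable_times wm measurable_restrict_space1 borel_measurable_indicator) simp
      show "integrable (lebesgue_on \<Omega>) (\<lambda>x. norm (w x))" using w by simp
      show "AE x in lebesgue_on \<Omega>. (\<lambda>k. w x * box_bump a b k x) \<longlonglongrightarrow> w x * indicator (box a b) x"
        by (intro AE_I2 tendsto_mult tendsto_const box_bump_tendsto)
      show "AE x in lebesgue_on \<Omega>. norm (w x * box_bump a b k x) \<le> norm (w x)" for k
        using box_bump_bounds[of a b k] by (auto simp: abs_mult intro!: AE_I2 mult_left_le)
    qed
    moreover have "(\<integral>x. w x * box_bump a b k x \<partial>lebesgue_on \<Omega>) = 0" for k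
      by (intro ortho box_bump_test_function ab)
    ultimately show ?thesis by (simp add: LIMSEQ_const_iff)
  qed
  define v where "v x = indicator (box c d) x * w x" for x
  have sub': "box c d \<subseteq> \<Omega>" using sub box_subset_cbox by blast
  have vI: "integrable lebesgue v"
  proof -
    have "integrable (lebesgue_on \<Omega>) (\<lambda>x. indicator (\<Omega> \<inter> box c d) x *\<^sub>R w x)"
      using w by (intro integrable_mult_indicator) (auto simp: sets_restrict_space)
    then have "integrable lebesgue (\<lambda>x. indicator \<Omega> x *\<^sub>R (indicator (\<Omega> \<inter> box c d) x *\<^sub>R w x))"
      by (subst (asm) integrable_restrict_space) auto
    also have "(\<lambda>x. indicator \<Omega> x *\<^sub>R (indicator (\<Omega> \<inter> box c d) x *\<^sub>R w x)) = v"
      using sub' by (auto simp: v_def fun_eq_iff indicator_def)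
    finally show ?thesis .
  qed
  have v0: "(\<integral>x. indicator (box a b) x * v x \<partial>lebesgue) = 0" for a b
  proof -
    obtain a' b' where ab: "box a b \<inter> box c d = box a' b'" "cbox a' b' \<subseteq> \<Omega>"
    proof (rule that[OF box_Int_box])
      show "cbox (\<Sum>i\<in>Basis. max (a \<bullet> i) (c \<bullet> i) *\<^sub>R i) (\<Sum>i\<in>Basis. min (b \<bullet> i) (d \<bullet> i) *\<^sub>R i) \<subseteq> \<Omega>"
        unfolding Int_interval[symmetric] using sub by blast
    qed
    have "(\<integral>x. indicator (box a b) x * v x \<partial>lebesgue) =
        (\<integral>x. indicator \<Omega> x *\<^sub>R (w x * indicator (box a' b') x) \<partial>lebesgue)"
      using sub' unfolding v_def ab(1)[symmetric]
      by (intro Bochner_Integration.integral_cong) (auto simp: indicator_def)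
    also have "\<dots> = (\<integral>x. w x * indicator (box a' b') x \<partial>lebesgue_on \<Omega>)"
      by (rule integral_restrict_space[symmetric]) auto
    finally show ?thesis using box0[OF ab(2)] by simp
  qed
  have "AE x in lebesgue. v x = 0"
  proof (rule AE_lebesgue_eq_0_if_box_integrals_0[OF vI _ v0])
    have "(\<integral>x. v x \<partial>lebesgue) = (\<integral>x. indicator (box c d) x * v x \<partial>lebesgue)"
      by (intro Bochner_Integration.integral_cong) (auto simp: v_def indicator_def)
    then show "(\<integral>x. v x \<partial>lebesgue) = 0" using v0 by simp
  qed
  then show ?thesis by eventually_elim (auto simp: v_def)
qed

text \<open>An open set is a countable union of closed boxes, and the boundary of a box is a null set.\<close>

lemma fundamental_lemma_of_calculus_of_variations:
  fixes w :: "'a::euclidean_space \<Rightarrow> real"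
  assumes w: "integrable (lebesgue_on \<Omega>) w" and \<Omega>: "open \<Omega>"
    and ortho: "\<And>\<psi>. \<psi> \<in> test_functions \<Omega> \<Longrightarrow> (\<integral>x. w x * \<psi> x \<partial>lebesgue_on \<Omega>) = 0"
  shows "AE x in lebesgue_on \<Omega>. w x = 0"
proof -
  obtain \<D> where \<D>: "countable \<D>" "\<D> \<subseteq> Pow \<Omega>" "\<And>X. X \<in> \<D> \<Longrightarrow> \<exists>a b. X = cbox a b" "\<Union>\<D> = \<Omega>"
    using open_countable_Union_open_cbox[OF \<Omega>] by metis
  have "AE x in lebesgue. x \<in> X \<longrightarrow> w x = 0" if X: "X \<in> \<D>" for X
  proof -
    obtain a b where ab: "X = cbox a b" using \<D>(3)[OF X] by auto
    have "AE x in lebesgue. x \<notin> cbox a b - box a b"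
      by (intro AE_not_in) (auto simp: negligible_iff_null_sets[symmetric] negligible_frontier_interval)
    moreover have "AE x in lebesgue. x \<in> box a b \<longrightarrow> w x = 0"
      using AE_zero_on_box[OF w \<Omega> ortho] X ab \<D>(2) by auto
    ultimately show ?thesis by eventually_elim (auto simp: ab)
  qed
  then have "AE x in lebesgue. \<forall>X\<in>\<D>. x \<in> X \<longrightarrow> w x = 0"
    by (subst AE_ball_countable[OF \<D>(1)]) blast
  then have "AE x in lebesgue. x \<in> \<Omega> \<longrightarrow> w x = 0"
    by eventually_elim (use \<D>(4) in auto)
  then show ?thesis using \<Omega> by (simp add: AE_restrict_space_iff)
qed

section \<open>Square integrable functions and the weak Laplacian\<close>

lemma integrable_inner_L2:
  fixes u v :: "'a::euclidean_space \<Rightarrow> 'b::euclidean_space"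
  assumes u: "u \<in> L2 \<Omega>" and v: "v \<in> L2 \<Omega>"
  shows "integrable (lebesgue_on \<Omega>) (\<lambda>x. u x \<bullet> v x)"
proof (rule Bochner_Integration.integrable_bound)
  show "integrable (lebesgue_on \<Omega>) (\<lambda>x. (norm (u x))\<^sup>2 + (norm (v x))\<^sup>2)"
    using u v by (auto simp: L2_def)
  show "(\<lambda>x. u x \<bullet> v x) \<in> borel_measurable (lebesgue_on \<Omega>)"
    using u v by (auto simp: L2_def)
  have "\<bar>a \<bullet> b\<bar> \<le> (norm a)\<^sup>2 + (norm b)\<^sup>2" for a b :: 'b
    using Cauchy_Schwarz_ineq2[of a b] sum_squares_bound[of "norm a" "norm b"]
      mult_nonneg_nonneg[OF norm_ge_zero[of a] norm_ge_zero[of b]] by linarith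
  then show "AE x in lebesgue_on \<Omega>. norm (u x \<bullet> v x) \<le> norm ((norm (u x))\<^sup>2 + (norm (v x))\<^sup>2)"
    by auto
qed

lemma integrable_mult_L2:
  fixes u v :: "'a::euclidean_space \<Rightarrow> real"
  assumes "u \<in> L2 \<Omega>" "v \<in> L2 \<Omega>"
  shows "integrable (lebesgue_on \<Omega>) (\<lambda>x. u x * v x)"
  using integrable_inner_L2[OF assms] by simp

lemma L2_add:
  fixes u v :: "'a::euclidean_space \<Rightarrow> 'b::euclidean_space"
  assumes u: "u \<in> L2 \<Omega>" and v: "v \<in> L2 \<Omega>"
  shows "(\<lambda>x. u x + v x) \<in> L2 \<Omega>"
proof -
  have "integrable (lebesgue_on \<Omega>) (\<lambda>x. (u x \<bullet> u x + v x \<bullet> v x) + 2 * (u x \<bullet> v x))"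
    using integrable_inner_L2[OF u v] integrable_inner_L2[OF u u]
      integrable_inner_L2[OF v v] by auto
  then have "integrable (lebesgue_on \<Omega>) (\<lambda>x. (norm (u x + v x))\<^sup>2)"
    by (simp add: dot_square_norm[symmetric] inner_add inner_commute algebra_simps)
  with u v show ?thesis by (auto simp: L2_def)
qed

lemma L2_scaleR:
  fixes u :: "'a::euclidean_space \<Rightarrow> 'b::euclidean_space"
  assumes "u \<in> L2 \<Omega>"
  shows "(\<lambda>x. c *\<^sub>R u x) \<in> L2 \<Omega>"
  using assms by (auto simp: L2_def power_mult_distrib)

lemma L2_lincomb:
  fixes u v :: "'a::euclidean_space \<Rightarrow> real"
  assumes "u \<in> L2 \<Omega>" "v \<in> L2 \<Omega>"
  shows "(\<lambda>x. \<alpha> * u x + \<beta> * v x) \<in> L2 \<Omega>"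
  using L2_add[OF L2_scaleR[OF assms(1), of \<alpha>] L2_scaleR[OF assms(2), of \<beta>]] by simp

lemma L2_diff:
  fixes u v :: "'a::euclidean_space \<Rightarrow> 'b::euclidean_space"
  assumes "u \<in> L2 \<Omega>" "v \<in> L2 \<Omega>"
  shows "(\<lambda>x. u x - v x) \<in> L2 \<Omega>"
  using L2_add[OF assms(1) L2_scaleR[OF assms(2), of "-1"]] by simp

lemma finite_measure_lebesgue_on_bounded_open:
  "bounded \<Omega> \<Longrightarrow> open \<Omega> \<Longrightarrow> finite_measure (lebesgue_on \<Omega>)"
  by (intro finite_measure_lebesgue_on bounded_set_imp_lmeasurable) auto

lemma L2_const:
  assumes "bounded \<Omega>" "open \<Omega>"
  shows "(\<lambda>x. c) \<in> L2 \<Omega>"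
proof -
  interpret finite_measure "lebesgue_on \<Omega>"
    using assms by (rule finite_measure_lebesgue_on_bounded_open)
  show ?thesis by (simp add: L2_def)
qed

text \<open>Superposition with a function of linear growth preserves \<open>L\<^sup>2\<close> on a domain of finite measure; it is
  applied to the nonlinearity \<open>f\<close>, whose derivative is bounded.\<close>

lemma L2_of_linear_growth:
  fixes g :: "real \<Rightarrow> real"
  assumes \<Omega>: "bounded \<Omega>" "open \<Omega>" and u: "u \<in> L2 \<Omega>"
    and g: "continuous_on UNIV g" and growth: "\<And>s. \<bar>g s\<bar> \<le> a + b * \<bar>s\<bar>"
  shows "(\<lambda>x. g (u x)) \<in> L2 \<Omega>"
proof -
  have um [measurable]: "u \<in> borel_measurable (lebesgue_on \<Omega>)" using u by (simp add: L2_def)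
  have gm [measurable]: "g \<in> borel_measurable borel" using g by (rule borel_measurable_continuous_onI)
  have "(\<lambda>x. norm (u x)) \<in> L2 \<Omega>" using u by (simp add: L2_def)
  then have "(\<lambda>x. a * 1 + b * norm (u x)) \<in> L2 \<Omega>"
    by (intro L2_lincomb L2_const \<Omega>)
  then have "integrable (lebesgue_on \<Omega>) (\<lambda>x. (norm (a + b * norm (u x)))\<^sup>2)"
    by (simp add: L2_def)
  then have "integrable (lebesgue_on \<Omega>) (\<lambda>x. (norm (g (u x)))\<^sup>2)"
  proof (rule Bochner_Integration.integrable_bound)
    show "AE x in lebesgue_on \<Omega>. norm ((norm (g (u x)))\<^sup>2) \<le> norm ((norm (a + b * norm (u x)))\<^sup>2)"
    proof (intro AE_I2)
      fix x
      have "\<bar>g (u x)\<bar> \<le> \<bar>a + b * \<bar>u x\<bar>\<bar>" using growth[of "u x"] by linarith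
      then show "norm ((norm (g (u x)))\<^sup>2) \<le> norm ((norm (a + b * norm (u x)))\<^sup>2)"
        by (simp add: abs_le_square_iff)
    qed
  qed measurable
  then show ?thesis by (simp add: L2_def)
qed

text \<open>Boundedness comes from compactness of \<open>closure \<Omega>\<close>; continuity on the whole space matters here. In
  this way test functions and their derivatives are admissible factors against \<open>L\<^sup>2\<close> functions.\<close>

lemma L2_of_continuous:
  assumes \<Omega>: "bounded \<Omega>" "open \<Omega>" and g: "continuous_on UNIV g"
  shows "(g :: 'a::euclidean_space \<Rightarrow> real) \<in> L2 \<Omega>"
proof -
  have gm: "g \<in> borel_measurable (lebesgue_on \<Omega>)"
    by (intro measurable_restrict_space1 measurable_completion)
      (simp add: borel_measurable_continuous_onI[OF g])
  have "compact (g ` closure \<Omega>)"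
    using \<Omega> by (intro compact_continuous_image continuous_on_subset[OF g]) auto
  then obtain C where C: "\<And>x. x \<in> closure \<Omega> \<Longrightarrow> norm (g x) \<le> C"
    by (meson bounded_iff compact_imp_bounded imageI)
  interpret finite_measure "lebesgue_on \<Omega>"
    using \<Omega> by (rule finite_measure_lebesgue_on_bounded_open)
  have "integrable (lebesgue_on \<Omega>) (\<lambda>x. (norm (g x))\<^sup>2)"
  proof (rule integrable_const_bound[where B = "C\<^sup>2"])
    have "(norm (g x))\<^sup>2 \<le> C\<^sup>2" if "x \<in> \<Omega>" for x
      using C[of x] closure_subset[of \<Omega>] that by (intro power_mono) auto
    then show "AE x in lebesgue_on \<Omega>. norm ((norm (g x))\<^sup>2) \<le> C\<^sup>2"
      by (intro AE_I2) auto
  qed (use gm in measurable)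
  with gm show ?thesis by (simp add: L2_def)
qed

lemma continuous_partial_partial:
  assumes "\<psi> \<in> test_functions \<Omega>" "b \<in> Basis" "c \<in> Basis"
  shows "continuous_on UNIV (partial b (partial c \<psi>))"
proof -
  have "Ck (Suc (Suc 0)) \<psi>" using assms(1) unfolding test_functions_def by blast
  then show ?thesis using assms(2,3) by simp
qed

lemma has_weak_laplacian_lincomb:
  fixes \<Omega> :: "'a::euclidean_space set"
  assumes \<Omega>: "bounded \<Omega>" "open \<Omega>" and L2: "u \<in> L2 \<Omega>" "v \<in> L2 \<Omega>"
    and lap: "has_weak_laplacian \<Omega> u w" "has_weak_laplacian \<Omega> v z"
  shows "has_weak_laplacian \<Omega> (\<lambda>x. \<alpha> * u x + \<beta> * v x) (\<lambda>x. \<alpha> * w x + \<beta> * z x)"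
proof -
  have wz: "w \<in> L2 \<Omega>" "z \<in> L2 \<Omega>" using lap by (auto simp: has_weak_laplacian_def)
  have "(\<integral>x. (\<alpha> * u x + \<beta> * v x) * (\<Sum>b\<in>Basis. partial b (partial b \<psi>) x) \<partial>lebesgue_on \<Omega>) =
      (\<integral>x. (\<alpha> * w x + \<beta> * z x) * \<psi> x \<partial>lebesgue_on \<Omega>)" if \<psi>: "\<psi> \<in> test_functions \<Omega>" for \<psi>
  proof -
    define l where "l x = (\<Sum>b\<in>Basis. partial b (partial b \<psi>) x)" for x
    have l: "l \<in> L2 \<Omega>"
      unfolding l_def
      by (intro L2_of_continuous \<Omega> continuous_on_sum continuous_partial_partial[OF \<psi>])
    have "Ck 0 \<psi>" using \<psi> unfolding test_functions_def by blast
    then have \<psi>2: "\<psi> \<in> L2 \<Omega>" by (intro L2_of_continuous \<Omega>) simp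
    have split: "(\<integral>x. (\<alpha> * p x + \<beta> * q x) * r x \<partial>lebesgue_on \<Omega>) =
        \<alpha> * (\<integral>x. p x * r x \<partial>lebesgue_on \<Omega>) + \<beta> * (\<integral>x. q x * r x \<partial>lebesgue_on \<Omega>)"
      if "p \<in> L2 \<Omega>" "q \<in> L2 \<Omega>" "r \<in> L2 \<Omega>" for p q r :: "'a \<Rightarrow> real"
      using integrable_mult_L2[OF that(1,3)] integrable_mult_L2[OF that(2,3)]
      by (simp add: distrib_right mult.assoc)
    have "(\<integral>x. u x * l x \<partial>lebesgue_on \<Omega>) = (\<integral>x. w x * \<psi> x \<partial>lebesgue_on \<Omega>)"
      "(\<integral>x. v x * l x \<partial>lebesgue_on \<Omega>) = (\<integral>x. z x * \<psi> x \<partial>lebesgue_on \<Omega>)"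
      using lap \<psi> by (auto simp: has_weak_laplacian_def l_def)
    then show ?thesis
      unfolding l_def[symmetric] by (simp add: split l \<psi>2 L2 wz)
  qed
  then show ?thesis
    by (simp add: has_weak_laplacian_def L2_lincomb wz)
qed

lemma weak_laplacian_unique_AE:
  fixes \<Omega> :: "'a::euclidean_space set"
  assumes \<Omega>: "bounded \<Omega>" "open \<Omega>"
    and w: "has_weak_laplacian \<Omega> u w" and z: "has_weak_laplacian \<Omega> u z"
  shows "AE x in lebesgue_on \<Omega>. w x = z x"
proof -
  have wz: "w \<in> L2 \<Omega>" "z \<in> L2 \<Omega>" using w z by (auto simp: has_weak_laplacian_def)
  have "AE x in lebesgue_on \<Omega>. w x - z x = 0"
  proof (rule fundamental_lemma_of_calculus_of_variations)
    show "integrable (lebesgue_on \<Omega>) (\<lambda>x. w x - z x)"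
      using integrable_mult_L2[OF L2_diff[OF wz] L2_const[OF \<Omega>, of 1]] by simp
    fix \<psi> assume \<psi>: "\<psi> \<in> test_functions \<Omega>"
    have "Ck 0 \<psi>" using \<psi> unfolding test_functions_def by blast
    then have \<psi>2: "\<psi> \<in> L2 \<Omega>" by (intro L2_of_continuous \<Omega>) simp
    have "(\<integral>x. w x * \<psi> x \<partial>lebesgue_on \<Omega>) = (\<integral>x. z x * \<psi> x \<partial>lebesgue_on \<Omega>)"
      using w z \<psi> by (simp add: has_weak_laplacian_def)
    then show "(\<integral>x. (w x - z x) * \<psi> x \<partial>lebesgue_on \<Omega>) = 0"
      by (simp add: left_diff_distrib integrable_mult_L2 wz \<psi>2)
  qed (rule \<Omega>)
  then show ?thesis by eventually_elim simp
qed

lemma has_weak_laplacian_wlap: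
  "has_weak_laplacian \<Omega> u w \<Longrightarrow> has_weak_laplacian \<Omega> u (wlap \<Omega> u)"
  unfolding wlap_def by (rule someI[of "has_weak_laplacian \<Omega> u"])

text \<open>The operator \<open>wlap\<close> picks an arbitrary representative, so it is linear only almost everywhere, and
  this rests on the uniqueness of the weak Laplacian. The lemma is needed because the scheme applies
  \<open>wlap\<close> to averages and differences of time levels.\<close>

lemma wlap_lincomb_AE:
  fixes \<Omega> :: "'a::euclidean_space set"
  assumes \<Omega>: "bounded \<Omega>" "open \<Omega>"
    and u: "u \<in> neumann_functions \<Omega>" and v: "v \<in> neumann_functions \<Omega>"
  shows "AE x in lebesgue_on \<Omega>.
    wlap \<Omega> (\<lambda>x. \<alpha> * u x + \<beta> * v x) x = \<alpha> * wlap \<Omega> u x + \<beta> * wlap \<Omega> v x"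
proof -
  have "has_weak_laplacian \<Omega> (\<lambda>x. \<alpha> * u x + \<beta> * v x) (\<lambda>x. \<alpha> * wlap \<Omega> u x + \<beta> * wlap \<Omega> v x)"
    using u v by (intro has_weak_laplacian_lincomb \<Omega>)
      (auto simp: neumann_functions_def H1_def intro: has_weak_laplacian_wlap)
  with weak_laplacian_unique_AE[OF \<Omega> has_weak_laplacian_wlap] show ?thesis by blast
qed

lemma wgrad_L2:
  assumes "u \<in> H1 \<Omega>"
  shows "wgrad \<Omega> u \<in> L2 \<Omega>"
proof -
  have "\<exists>g. has_weak_gradient \<Omega> u g" using assms by (simp add: H1_def)
  then have "has_weak_gradient \<Omega> u (wgrad \<Omega> u)" unfolding wgrad_def by (rule someI_ex)
  then show ?thesis by (simp add: has_weak_gradient_def)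
qed

lemma neumann_functionsD:
  assumes "u \<in> neumann_functions \<Omega>"
  shows "u \<in> L2 \<Omega>" "wgrad \<Omega> u \<in> L2 \<Omega>" "wlap \<Omega> u \<in> L2 \<Omega>"
proof -
  have H1: "u \<in> H1 \<Omega>" using assms by (simp add: neumann_functions_def)
  then show "u \<in> L2 \<Omega>" by (simp add: H1_def)
  from H1 show "wgrad \<Omega> u \<in> L2 \<Omega>" by (rule wgrad_L2)
  obtain w where "has_weak_laplacian \<Omega> u w" using assms by (auto simp: neumann_functions_def)
  then have "has_weak_laplacian \<Omega> u (wlap \<Omega> u)" by (rule has_weak_laplacian_wlap)
  then show "wlap \<Omega> u \<in> L2 \<Omega>" by (simp add: has_weak_laplacian_def)
qed

text \<open>The normal derivative is by definition the defect in Green's formula.\<close>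

lemma neumann_green:
  assumes u: "u \<in> neumann_functions \<Omega>" and v: "v \<in> neumann_functions \<Omega>"
  shows "(\<integral>x. v x * wlap \<Omega> u x \<partial>lebesgue_on \<Omega>) = - (\<integral>x. wgrad \<Omega> u x \<bullet> wgrad \<Omega> v x \<partial>lebesgue_on \<Omega>)"
proof -
  have "normal_derivative \<Omega> u v = 0" using u v by (auto simp: neumann_functions_def)
  then show ?thesis
    unfolding normal_derivative_def
    using integrable_inner_L2[OF neumann_functionsD(2)[OF u] neumann_functionsD(2)[OF v]]
      integrable_mult_L2[OF neumann_functionsD(1)[OF v] neumann_functionsD(3)[OF u]]
    by simp
qed

section \<open>The nonlinear potential\<close>

lemma quadratic_taylor_bound:
  fixes F f f' :: "real \<Rightarrow> real"
  assumes F: "\<And>s. (F has_real_derivative f s) (at s)"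
    and f: "\<And>s. (f has_real_derivative f' s) (at s)"
    and L: "\<And>s. \<bar>f' s\<bar> \<le> L"
  shows "\<bar>F y - F x - f x * (y - x)\<bar> \<le> L / 2 * (y - x)\<^sup>2"
proof (cases "y = x")
  case False
  define diff where "diff m = (if m = 0 then F else if m = 1 then f else f')" for m :: nat
  have "\<exists>t. (if y < x then y < t \<and> t < x else x < t \<and> t < y) \<and>
      F y = (\<Sum>m<2. diff m x / fact m * (y - x) ^ m) + diff 2 t / fact 2 * (y - x) ^ 2"
    by (rule Taylor[where a = "min x y" and b = "max x y"])
      (use False F f in \<open>auto simp: diff_def less_2_cases_iff\<close>)
  then obtain t where "F y = (\<Sum>m<2. diff m x / fact m * (y - x) ^ m) + diff 2 t / fact 2 * (y - x) ^ 2"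
    by blast
  then have "F y - F x - f x * (y - x) = f' t / 2 * (y - x)\<^sup>2"
    by (simp add: diff_def numeral_2_eq_2)
  then have "\<bar>F y - F x - f x * (y - x)\<bar> = \<bar>f' t\<bar> / 2 * (y - x)\<^sup>2"
    by (simp only:) (simp add: abs_mult)
  also have "\<dots> \<le> L / 2 * (y - x)\<^sup>2"
    using L[of t] by (intro mult_right_mono) auto
  finally show ?thesis .
qed simp

lemma linear_growth_of_bounded_deriv:
  fixes f f' :: "real \<Rightarrow> real"
  assumes f: "\<And>s. (f has_real_derivative f' s) (at s)" and L: "\<And>s. \<bar>f' s\<bar> \<le> L"
  shows "\<bar>f s\<bar> \<le> \<bar>f 0\<bar> + L * \<bar>s\<bar>"
proof -
  have "norm (f s - f 0) \<le> L * norm (s - 0)"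
    by (rule field_differentiable_bound[of UNIV f f']) (use f L in auto)
  then show ?thesis by simp
qed

text \<open>Both Taylor expansions are made at the extrapolated value \<open>h = 3/2 q - 1/2 r\<close>, the point at which the
  scheme evaluates \<open>f\<close>. The remainders involve \<open>q - h = - (q - r) / 2\<close> and
  \<open>p - h = ((p - q) + (p - 2 q + r)) / 2\<close>, which is why the squares of exactly these differences appear.\<close>

lemma extrapolated_potential_increment:
  fixes F f f' :: "real \<Rightarrow> real" and p q r :: real
  assumes F: "\<And>s. (F has_real_derivative f s) (at s)"
    and f: "\<And>s. (f has_real_derivative f' s) (at s)"
    and L: "\<And>s. \<bar>f' s\<bar> \<le> L"
  shows "F p - F q - f (3 / 2 * q - 1 / 2 * r) * (p - q) \<le>
    L / 4 * ((p - q)\<^sup>2 + (q - r)\<^sup>2 + (p - 2 * q + r)\<^sup>2)"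
proof -
  define h where "h = 3 / 2 * q - 1 / 2 * r"
  have "0 \<le> L" using L[of 0] by simp
  have "F p - F q - f h * (p - q) = (F p - F h - f h * (p - h)) - (F q - F h - f h * (q - h))"
    by (simp add: algebra_simps)
  also have "\<dots> \<le> L / 2 * (p - h)\<^sup>2 + L / 2 * (q - h)\<^sup>2"
    using quadratic_taylor_bound[OF F f L, of p h] quadratic_taylor_bound[OF F f L, of q h] by linarith
  also have "\<dots> = L / 2 * ((p - h)\<^sup>2 + (q - h)\<^sup>2)" by (simp add: distrib_left)
  also have "\<dots> \<le> L / 2 * (((p - q)\<^sup>2 + (q - r)\<^sup>2 + (p - 2 * q + r)\<^sup>2) / 2)"
  proof (intro mult_left_mono)
    have "((p - q)\<^sup>2 + (q - r)\<^sup>2 + (p - 2 * q + r)\<^sup>2) / 2 - ((p - h)\<^sup>2 + (q - h)\<^sup>2) =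
        (((p - q) - (p - 2 * q + r))\<^sup>2 + (q - r)\<^sup>2) / 4"
      unfolding h_def by (simp add: power2_eq_square field_simps)
    also have "\<dots> \<ge> 0" by simp
    finally show "(p - h)\<^sup>2 + (q - h)\<^sup>2 \<le> ((p - q)\<^sup>2 + (q - r)\<^sup>2 + (p - 2 * q + r)\<^sup>2) / 2" by simp
  qed (use \<open>0 \<le> L\<close> in simp)
  finally show ?thesis by (simp add: h_def)
qed

text \<open>A potential with bounded second derivative grows at most quadratically.\<close>

lemma integrable_potential:
  fixes F f f' :: "real \<Rightarrow> real"
  assumes \<Omega>: "bounded \<Omega>" "open \<Omega>" and u: "u \<in> L2 \<Omega>"
    and F: "\<And>s. (F has_real_derivative f s) (at s)"
    and f: "\<And>s. (f has_real_derivative f' s) (at s)"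
    and L: "\<And>s. \<bar>f' s\<bar> \<le> L"
  shows "integrable (lebesgue_on \<Omega>) (\<lambda>x. F (u x))"
proof (rule Bochner_Integration.integrable_bound)
  have um [measurable]: "u \<in> borel_measurable (lebesgue_on \<Omega>)" using u by (simp add: L2_def)
  have Fm [measurable]: "F \<in> borel_measurable borel"
    by (intro borel_measurable_continuous_onI continuous_at_imp_continuous_on ballI DERIV_isCont[OF F])
  show "(\<lambda>x. F (u x)) \<in> borel_measurable (lebesgue_on \<Omega>)" by measurable
  have 1: "(\<lambda>x. 1) \<in> L2 \<Omega>" by (rule L2_const[OF \<Omega>])
  have "integrable (lebesgue_on \<Omega>) (\<lambda>x. u x)" "integrable (lebesgue_on \<Omega>) (\<lambda>x. 1 :: real)"
    "integrable (lebesgue_on \<Omega>) (\<lambda>x. (u x)\<^sup>2)"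
    using integrable_mult_L2[OF u 1] integrable_mult_L2[OF 1 1] integrable_mult_L2[OF u u]
    by (auto simp: power2_eq_square)
  then show "integrable (lebesgue_on \<Omega>) (\<lambda>x. \<bar>F 0\<bar> * 1 + \<bar>f 0\<bar> * \<bar>u x\<bar> + L / 2 * (u x)\<^sup>2)"
    by (intro Bochner_Integration.integrable_add integrable_mult_right integrable_abs) auto
  have "\<bar>F s\<bar> \<le> \<bar>F 0\<bar> * 1 + \<bar>f 0\<bar> * \<bar>s\<bar> + L / 2 * s\<^sup>2" for s
    using quadratic_taylor_bound[OF F f L, of s 0, unfolded diff_zero] abs_mult[of "f 0" s]
    by linarith
  then show "AE x in lebesgue_on \<Omega>. norm (F (u x)) \<le>
      norm (\<bar>F 0\<bar> * 1 + \<bar>f 0\<bar> * \<bar>u x\<bar> + L / 2 * (u x)\<^sup>2)"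
    by (intro AE_I2) (metis abs_ge_self order_trans real_norm_def)
qed

section \<open>Energy balance of one time step\<close>

lemma L2_norm_squared: "(L2_norm \<Omega> u)\<^sup>2 = (\<integral>x. (norm (u x))\<^sup>2 \<partial>lebesgue_on \<Omega>)"
  by (simp add: L2_norm_def)

lemma energy_eq:
  fixes F f f' :: "real \<Rightarrow> real"
  assumes \<Omega>: "bounded \<Omega>" "open \<Omega>" and u: "u \<in> neumann_functions \<Omega>"
    and F: "\<And>s. (F has_real_derivative f s) (at s)"
    and f: "\<And>s. (f has_real_derivative f' s) (at s)"
    and L: "\<And>s. \<bar>f' s\<bar> \<le> L"
  shows "energy \<Omega> \<epsilon> F u = \<epsilon> / 2 * (\<integral>x. wgrad \<Omega> u x \<bullet> wgrad \<Omega> u x \<partial>lebesgue_on \<Omega>) +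
    1 / \<epsilon> * (\<integral>x. F (u x) \<partial>lebesgue_on \<Omega>)"
  using integrable_potential[OF \<Omega> neumann_functionsD(1)[OF u] F f L]
    integrable_inner_L2[OF neumann_functionsD(2)[OF u] neumann_functionsD(2)[OF u]]
  by (simp add: energy_def dot_square_norm)

text \<open>The first equation of the scheme and Green's formula give
  \<open>\<parallel>p - q\<parallel>\<^sup>2 = - \<gamma> \<tau> \<integral> \<nabla>m \<bullet> (\<nabla>p - \<nabla>q)\<close>, and Young's inequality is the nonnegativity of the
  integral of \<open>\<bar>\<surd>\<gamma> \<nabla>m + \<surd>A (\<nabla>p - \<nabla>q)\<bar>\<^sup>2\<close>. The last factor on the right is
  \<open>\<parallel>\<nabla>p - \<nabla>q\<parallel>\<^sup>2\<close>, expanded because Green's formula pairs with the gradients of \<open>p\<close> and \<open>q\<close> separately.\<close>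

lemma interpolation_inequality:
  fixes m p q :: "'a::euclidean_space \<Rightarrow> real"
  assumes m: "m \<in> neumann_functions \<Omega>" and p: "p \<in> neumann_functions \<Omega>" and q: "q \<in> neumann_functions \<Omega>"
    and pos: "\<gamma> > 0" "\<tau> > 0" "A \<ge> 0"
    and eq: "AE x in lebesgue_on \<Omega>. p x - q x = \<gamma> * \<tau> * wlap \<Omega> m x"
  defines "ip \<equiv> \<lambda>u v. \<integral>x. wgrad \<Omega> u x \<bullet> wgrad \<Omega> v x \<partial>lebesgue_on \<Omega>"
  shows "2 * sqrt (A / \<gamma>) * (\<integral>x. (p x - q x)\<^sup>2 \<partial>lebesgue_on \<Omega>) \<le>
    \<gamma> * \<tau> * ip m m + A * \<tau> * (ip p p - 2 * ip p q + ip q q)"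
proof -
  note L2s = neumann_functionsD[OF m] neumann_functionsD[OF p] neumann_functionsD[OF q]
  note int = integrable_inner_L2[OF L2s(2) L2s(2)] integrable_inner_L2[OF L2s(5) L2s(5)]
    integrable_inner_L2[OF L2s(8) L2s(8)] integrable_inner_L2[OF L2s(2) L2s(5)]
    integrable_inner_L2[OF L2s(2) L2s(8)] integrable_inner_L2[OF L2s(5) L2s(8)]
    integrable_mult_L2[OF L2s(4) L2s(3)] integrable_mult_L2[OF L2s(7) L2s(3)]
  have pq: "(\<integral>x. (p x - q x)\<^sup>2 \<partial>lebesgue_on \<Omega>) = - (\<gamma> * \<tau>) * (ip m p - ip m q)"
  proof -
    have "(\<integral>x. (p x - q x)\<^sup>2 \<partial>lebesgue_on \<Omega>) =
        (\<integral>x. \<gamma> * \<tau> * (p x * wlap \<Omega> m x - q x * wlap \<Omega> m x) \<partial>lebesgue_on \<Omega>)"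
    proof (rule integral_cong_AE)
      show "AE x in lebesgue_on \<Omega>. (p x - q x)\<^sup>2 = \<gamma> * \<tau> * (p x * wlap \<Omega> m x - q x * wlap \<Omega> m x)"
        using eq
      proof eventually_elim
        case (elim x)
        have "(p x - q x)\<^sup>2 = (p x - q x) * (\<gamma> * \<tau> * wlap \<Omega> m x)"
          by (simp add: elim power2_eq_square)
        then show ?case by (simp add: algebra_simps)
      qed
    qed (use L2s in \<open>auto simp: L2_def\<close>)
    also have "\<dots> = \<gamma> * \<tau> * ((\<integral>x. p x * wlap \<Omega> m x \<partial>lebesgue_on \<Omega>) - (\<integral>x. q x * wlap \<Omega> m x \<partial>lebesgue_on \<Omega>))"
      using int by simp
    also have "\<dots> = - (\<gamma> * \<tau>) * (ip m p - ip m q)"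
      by (simp add: neumann_green[OF m p] neumann_green[OF m q] ip_def algebra_simps)
    finally show ?thesis .
  qed
  have "0 \<le> (\<integral>x. (norm (sqrt \<gamma> *\<^sub>R wgrad \<Omega> m x + sqrt A *\<^sub>R (wgrad \<Omega> p x - wgrad \<Omega> q x)))\<^sup>2 \<partial>lebesgue_on \<Omega>)"
    by simp
  also have "(\<lambda>x. (norm (sqrt \<gamma> *\<^sub>R wgrad \<Omega> m x + sqrt A *\<^sub>R (wgrad \<Omega> p x - wgrad \<Omega> q x)))\<^sup>2) =
      (\<lambda>x. \<gamma> * (wgrad \<Omega> m x \<bullet> wgrad \<Omega> m x)
         + A * (wgrad \<Omega> p x \<bullet> wgrad \<Omega> p x - 2 * (wgrad \<Omega> p x \<bullet> wgrad \<Omega> q x) + wgrad \<Omega> q x \<bullet> wgrad \<Omega> q x)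
         + 2 * (sqrt A * sqrt \<gamma>) * (wgrad \<Omega> m x \<bullet> wgrad \<Omega> p x - wgrad \<Omega> m x \<bullet> wgrad \<Omega> q x))"
  proof
    fix x
    have norm2: "(norm (s *\<^sub>R a + t *\<^sub>R (b - c)))\<^sup>2 = s\<^sup>2 * (a \<bullet> a) + t\<^sup>2 * (b \<bullet> b - 2 * (b \<bullet> c) + c \<bullet> c)
        + 2 * (t * s) * (a \<bullet> b - a \<bullet> c)" for a b c :: 'a and s t
      unfolding dot_square_norm[symmetric]
      by (simp add: inner_simps inner_commute power2_eq_square algebra_simps)
    show "(norm (sqrt \<gamma> *\<^sub>R wgrad \<Omega> m x + sqrt A *\<^sub>R (wgrad \<Omega> p x - wgrad \<Omega> q x)))\<^sup>2 =
      \<gamma> * (wgrad \<Omega> m x \<bullet> wgrad \<Omega> m x)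
         + A * (wgrad \<Omega> p x \<bullet> wgrad \<Omega> p x - 2 * (wgrad \<Omega> p x \<bullet> wgrad \<Omega> q x) + wgrad \<Omega> q x \<bullet> wgrad \<Omega> q x)
         + 2 * (sqrt A * sqrt \<gamma>) * (wgrad \<Omega> m x \<bullet> wgrad \<Omega> p x - wgrad \<Omega> m x \<bullet> wgrad \<Omega> q x)"
      using pos by (subst norm2) simp
  qed
  also have "(\<integral>x. \<gamma> * (wgrad \<Omega> m x \<bullet> wgrad \<Omega> m x)
         + A * (wgrad \<Omega> p x \<bullet> wgrad \<Omega> p x - 2 * (wgrad \<Omega> p x \<bullet> wgrad \<Omega> q x) + wgrad \<Omega> q x \<bullet> wgrad \<Omega> q x)
         + 2 * (sqrt A * sqrt \<gamma>) * (wgrad \<Omega> m x \<bullet> wgrad \<Omega> p x - wgrad \<Omega> m x \<bullet> wgrad \<Omega> q x) \<partial>lebesgue_on \<Omega>)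
      = \<gamma> * ip m m + A * (ip p p - 2 * ip p q + ip q q) + 2 * (sqrt A * sqrt \<gamma>) * (ip m p - ip m q)"
    using int by (simp add: ip_def)
  finally have "0 \<le> \<tau> * (\<gamma> * ip m m + A * (ip p p - 2 * ip p q + ip q q)
      + 2 * (sqrt A * sqrt \<gamma>) * (ip m p - ip m q))"
    using pos by simp
  moreover have "sqrt A * sqrt \<gamma> = sqrt (A / \<gamma>) * \<gamma>"
    using pos by (simp add: real_sqrt_divide real_div_sqrt field_simps)
  ultimately show ?thesis
    unfolding pq by (simp add: algebra_simps)
qed

text \<open>One time step in abstract form, with \<open>p\<close>, \<open>q\<close> the new and the old level, \<open>g\<close> the explicit nonlinear term
  and \<open>s\<close> the second difference: the second equation is multiplied by \<open>p - q\<close> and integrated. Expanding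
  the products leaves only pairings of \<open>p\<close>, \<open>q\<close> with their own Laplacians, to which Green's formula
  applies term by term; on the left the first equation turns \<open>p - q\<close> into a multiple of \<open>\<Delta>m\<close>.\<close>

lemma tested_scheme:
  fixes m p q g s :: "'a::euclidean_space \<Rightarrow> real"
  assumes \<Omega>: "bounded \<Omega>" "open \<Omega>"
    and m: "m \<in> neumann_functions \<Omega>" and p: "p \<in> neumann_functions \<Omega>" and q: "q \<in> neumann_functions \<Omega>"
    and g: "g \<in> L2 \<Omega>" and s: "s \<in> L2 \<Omega>"
    and eq1: "AE x in lebesgue_on \<Omega>. p x - q x = \<kappa> * wlap \<Omega> m x"
    and eq2: "AE x in lebesgue_on \<Omega>. m x = - \<epsilon> * wlap \<Omega> (\<lambda>y. (p y + q y) / 2) x + g x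
      - \<alpha> * wlap \<Omega> (\<lambda>y. p y - q y) x + B * s x"
  defines "ip \<equiv> \<lambda>u v. \<integral>x. wgrad \<Omega> u x \<bullet> wgrad \<Omega> v x \<partial>lebesgue_on \<Omega>"
  shows "- \<kappa> * ip m m = \<epsilon> / 2 * (ip p p - ip q q) + (\<integral>x. g x * (p x - q x) \<partial>lebesgue_on \<Omega>)
    + \<alpha> * (ip p p - 2 * ip p q + ip q q) + B * (\<integral>x. s x * (p x - q x) \<partial>lebesgue_on \<Omega>)"
proof -
  note mL = neumann_functionsD[OF m] and pL = neumann_functionsD[OF p] and qL = neumann_functionsD[OF q]
  define P Q W where "P = wlap \<Omega> p" and "Q = wlap \<Omega> q" and "W = wlap \<Omega> m"
  note PQW = pL(3)[folded P_def] qL(3)[folded Q_def] mL(3)[folded W_def]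
  note int = integrable_mult_L2[OF pL(1) PQW(1)] integrable_mult_L2[OF pL(1) PQW(2)]
    integrable_mult_L2[OF qL(1) PQW(1)] integrable_mult_L2[OF qL(1) PQW(2)]
    integrable_mult_L2[OF g L2_diff[OF pL(1) qL(1)]] integrable_mult_L2[OF s L2_diff[OF pL(1) qL(1)]]
  have avg: "AE x in lebesgue_on \<Omega>. wlap \<Omega> (\<lambda>y. (p y + q y) / 2) x = 1 / 2 * P x + 1 / 2 * Q x"
  proof -
    have "(\<lambda>y. (p y + q y) / 2) = (\<lambda>y. 1 / 2 * p y + 1 / 2 * q y)" by (auto simp: field_simps)
    then show ?thesis
      unfolding P_def Q_def using wlap_lincomb_AE[OF \<Omega> p q, of "1 / 2" "1 / 2"] by (simp only:)
  qed
  have dif: "AE x in lebesgue_on \<Omega>. wlap \<Omega> (\<lambda>y. p y - q y) x = P x - Q x"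
    unfolding P_def Q_def using wlap_lincomb_AE[OF \<Omega> p q, of 1 "-1"] by simp
  have "- \<kappa> * ip m m = (\<integral>x. \<kappa> * (m x * W x) \<partial>lebesgue_on \<Omega>)"
    by (simp add: ip_def W_def neumann_green[OF m m])
  also have "\<dots> = (\<integral>x. (- \<epsilon> / 2 - \<alpha>) * (p x * P x) + (- \<epsilon> / 2 + \<alpha>) * (p x * Q x)
      + (\<epsilon> / 2 + \<alpha>) * (q x * P x) + (\<epsilon> / 2 - \<alpha>) * (q x * Q x)
      + g x * (p x - q x) + B * (s x * (p x - q x)) \<partial>lebesgue_on \<Omega>)"
  proof (rule integral_cong_AE)
    show "AE x in lebesgue_on \<Omega>. \<kappa> * (m x * W x) =
      (- \<epsilon> / 2 - \<alpha>) * (p x * P x) + (- \<epsilon> / 2 + \<alpha>) * (p x * Q x)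
      + (\<epsilon> / 2 + \<alpha>) * (q x * P x) + (\<epsilon> / 2 - \<alpha>) * (q x * Q x)
      + g x * (p x - q x) + B * (s x * (p x - q x))"
      using eq1 eq2 avg dif
    proof eventually_elim
      case (elim x)
      have "\<kappa> * (m x * W x) = m x * (p x - q x)" by (simp add: elim(1) W_def)
      then show ?case by (simp add: elim(2-4) field_simps)
    qed
  qed (use mL pL qL PQW g s in \<open>auto simp: L2_def\<close>)
  also have "\<dots> = (- \<epsilon> / 2 - \<alpha>) * - ip p p + (- \<epsilon> / 2 + \<alpha>) * - ip q p
      + (\<epsilon> / 2 + \<alpha>) * - ip p q + (\<epsilon> / 2 - \<alpha>) * - ip q q
      + (\<integral>x. g x * (p x - q x) \<partial>lebesgue_on \<Omega>) + B * (\<integral>x. s x * (p x - q x) \<partial>lebesgue_on \<Omega>)"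
    using int neumann_green[OF p p] neumann_green[OF p q] neumann_green[OF q p] neumann_green[OF q q]
    by (simp add: ip_def P_def Q_def)
  also have "ip q p = ip p q" by (simp add: ip_def inner_commute)
  finally show ?thesis by (simp add: field_simps)
qed

theorem theorem2p1:
  fixes \<Omega> :: "(real ^ 'd) set"
    and \<epsilon> \<gamma> \<tau> A B L :: real
    and F f f' :: "real \<Rightarrow> real"
    and \<phi> \<mu> :: "nat \<Rightarrow> real ^ 'd \<Rightarrow> real"
  assumes "CARD('d) = 2 \<or> CARD('d) = 3"
    and "bounded_lipschitz_domain \<Omega>"
    and "\<epsilon> > 0" "\<gamma> > 0" "\<tau> > 0" "A \<ge> 0" "B \<ge> 0" "L \<ge> 0"
    and "\<And>s. (F has_real_derivative f s) (at s)"
    and "\<And>s. (f has_real_derivative f' s) (at s)"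
    and "\<And>s. \<bar>f' s\<bar> \<le> L"
    and "SL_CN_solution \<Omega> \<epsilon> \<gamma> \<tau> A B f \<phi> \<mu>"
    and "A \<ge> L\<^sup>2 / (16 * \<epsilon>\<^sup>2) * \<gamma>"
    and "B \<ge> L / (2 * \<epsilon>)"
  shows "\<forall>n\<ge>1. E_CN \<Omega> \<epsilon> F L B \<phi> (n + 1) \<le> E_CN \<Omega> \<epsilon> F L B \<phi> n
           - (2 * sqrt (A / \<gamma>) - L / (2 * \<epsilon>)) * (L2_norm \<Omega> (dt \<phi> (n + 1)))\<^sup>2
           - (B / 2 - L / (4 * \<epsilon>)) * (L2_norm \<Omega> (dtt \<phi> (n + 1)))\<^sup>2"
proof (intro allI impI)
  fix n :: nat assume n: "n \<ge> 1"
  note pos = \<open>\<epsilon> > 0\<close> \<open>\<gamma> > 0\<close> \<open>\<tau> > 0\<close> \<open>A \<ge> 0\<close>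
  note pot = assms(9-11)
  have \<Omega>: "bounded \<Omega>" "open \<Omega>" using assms(2) by (auto simp: bounded_lipschitz_domain_def)
  define p q r m where "p = \<phi> (n + 1)" and "q = \<phi> n" and "r = \<phi> (n - 1)" and "m = \<mu> n"
  have neu: "p \<in> neumann_functions \<Omega>" "q \<in> neumann_functions \<Omega>" "r \<in> neumann_functions \<Omega>"
    "m \<in> neumann_functions \<Omega>"
    using assms(12) n by (auto simp: SL_CN_solution_def p_def q_def r_def m_def)
  note pL = neumann_functionsD(1)[OF neu(1)] and qL = neumann_functionsD(1)[OF neu(2)]
    and rL = neumann_functionsD(1)[OF neu(3)]
  define d d' s h where "d x = p x - q x" and "d' x = q x - r x" and "s x = p x - 2 * q x + r x"
    and "h x = 3 / 2 * q x - 1 / 2 * r x" for x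
  have diffs: "dt \<phi> (n + 1) = d" "dt \<phi> n = d'" "dtt \<phi> (n + 1) = s"
    by (auto simp: fun_eq_iff dt_def dtt_def d_def d'_def s_def p_def q_def r_def)
  have dL: "d \<in> L2 \<Omega>" "d' \<in> L2 \<Omega>"
    unfolding d_def d'_def by (intro L2_diff pL qL rL)+
  have s_eq: "s x = d x - d' x" for x by (simp add: s_def d_def d'_def)
  have sL: "s \<in> L2 \<Omega>" using L2_diff[OF dL] by (simp add: s_eq[abs_def])
  have hL: "h \<in> L2 \<Omega>" using L2_lincomb[OF qL rL, of "3 / 2" "- (1 / 2)"] by (simp add: h_def[abs_def])
  have fh: "(\<lambda>x. f (h x)) \<in> L2 \<Omega>"
    by (rule L2_of_linear_growth[OF \<Omega> hL _ linear_growth_of_bounded_deriv[OF pot(2,3)]])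
      (intro continuous_at_imp_continuous_on ballI DERIV_isCont[OF pot(2)])
  define ip where "ip u v = (\<integral>x. wgrad \<Omega> u x \<bullet> wgrad \<Omega> v x \<partial>lebesgue_on \<Omega>)" for u v
  define N N' Z S where "N = (\<integral>x. (d x)\<^sup>2 \<partial>lebesgue_on \<Omega>)" and "N' = (\<integral>x. (d' x)\<^sup>2 \<partial>lebesgue_on \<Omega>)"
    and "Z = (\<integral>x. (s x)\<^sup>2 \<partial>lebesgue_on \<Omega>)" and "S = (\<integral>x. f (h x) * d x \<partial>lebesgue_on \<Omega>)"
  define FI where "FI u = (\<integral>x. F (u x) \<partial>lebesgue_on \<Omega>)" for u :: "real ^ 'd \<Rightarrow> real"
  have int: "integrable (lebesgue_on \<Omega>) (\<lambda>x. (d x)\<^sup>2)" "integrable (lebesgue_on \<Omega>) (\<lambda>x. (d' x)\<^sup>2)"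
    "integrable (lebesgue_on \<Omega>) (\<lambda>x. (s x)\<^sup>2)" "integrable (lebesgue_on \<Omega>) (\<lambda>x. f (h x) * d x)"
    "integrable (lebesgue_on \<Omega>) (\<lambda>x. F (p x))" "integrable (lebesgue_on \<Omega>) (\<lambda>x. F (q x))"
    using integrable_mult_L2[OF dL(1) dL(1)] integrable_mult_L2[OF dL(2) dL(2)]
      integrable_mult_L2[OF sL sL] integrable_mult_L2[OF fh dL(1)]
      integrable_potential[OF \<Omega> pL pot] integrable_potential[OF \<Omega> qL pot]
    by (auto simp: power2_eq_square)
  have eq1: "AE x in lebesgue_on \<Omega>. p x - q x = \<gamma> * \<tau> * wlap \<Omega> m x"
  proof -
    have "AE x in lebesgue_on \<Omega>. (p x - q x) / \<tau> = \<gamma> * wlap \<Omega> m x"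
      using assms(12) n by (simp add: SL_CN_solution_def p_def q_def m_def)
    then show ?thesis by eventually_elim (use pos in \<open>simp add: field_simps\<close>)
  qed
  have eq2: "AE x in lebesgue_on \<Omega>. m x = - \<epsilon> * wlap \<Omega> (\<lambda>y. (p y + q y) / 2) x + 1 / \<epsilon> * f (h x)
      - A * \<tau> * wlap \<Omega> (\<lambda>y. p y - q y) x + B * s x"
  proof -
    have "AE x in lebesgue_on \<Omega>. m x = - \<epsilon> * wlap \<Omega> (\<lambda>y. (p y + q y) / 2) x + 1 / \<epsilon> * f (h x)
      - A * \<tau> * wlap \<Omega> (dt \<phi> (n + 1)) x + B * dtt \<phi> (n + 1) x"
      using assms(12) n
      unfolding SL_CN_solution_def p_def q_def m_def r_def h_def by blast
    then show ?thesis by (simp only: diffs d_def[abs_def])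
  qed
  have gL: "(\<lambda>x. 1 / \<epsilon> * f (h x)) \<in> L2 \<Omega>" using L2_scaleR[OF fh, of "1 / \<epsilon>"] by simp
  have "- (\<gamma> * \<tau>) * ip m m = \<epsilon> / 2 * (ip p p - ip q q) + (\<integral>x. 1 / \<epsilon> * f (h x) * d x \<partial>lebesgue_on \<Omega>)
    + A * \<tau> * (ip p p - 2 * ip p q + ip q q) + B * (\<integral>x. s x * d x \<partial>lebesgue_on \<Omega>)"
    using tested_scheme[OF \<Omega> neu(4,1,2) gL sL eq1 eq2] unfolding ip_def d_def .
  also have "(\<integral>x. 1 / \<epsilon> * f (h x) * d x \<partial>lebesgue_on \<Omega>) = 1 / \<epsilon> * S"
    unfolding S_def by (simp only: mult.assoc integral_mult_right_zero)
  \<comment> \<open>Polarisation, since \<open>d - s = d'\<close>; the difference of squares telescopes in time.\<close>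
  also have "(\<integral>x. s x * d x \<partial>lebesgue_on \<Omega>) = (\<integral>x. 1 / 2 * ((d x)\<^sup>2 - (d' x)\<^sup>2 + (s x)\<^sup>2) \<partial>lebesgue_on \<Omega>)"
    by (intro Bochner_Integration.integral_cong) (auto simp: s_eq power2_eq_square algebra_simps)
  also have "\<dots> = 1 / 2 * (N - N' + Z)"
    using int by (simp add: N_def N'_def Z_def)
  finally have identity: "- (\<gamma> * \<tau>) * ip m m = \<epsilon> / 2 * (ip p p - ip q q) + 1 / \<epsilon> * S
    + A * \<tau> * (ip p p - 2 * ip p q + ip q q) + B * (1 / 2 * (N - N' + Z))" .
  have interp: "2 * sqrt (A / \<gamma>) * N \<le> \<gamma> * \<tau> * ip m m + A * \<tau> * (ip p p - 2 * ip p q + ip q q)"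
    using interpolation_inequality[OF neu(4,1,2) pos(2-4) eq1] unfolding ip_def N_def d_def .
  have "(\<integral>x. F (p x) - F (q x) - f (h x) * d x \<partial>lebesgue_on \<Omega>) \<le>
      (\<integral>x. L / 4 * ((d x)\<^sup>2 + (d' x)\<^sup>2 + (s x)\<^sup>2) \<partial>lebesgue_on \<Omega>)"
    using int extrapolated_potential_increment[OF pot]
    by (intro integral_mono) (auto simp: d_def d'_def s_def h_def)
  then have "FI p - FI q - S \<le> L / 4 * (N + N' + Z)"
    using int by (simp add: FI_def S_def N_def N'_def Z_def)
  then have scaled: "1 / \<epsilon> * (FI p - FI q - S) \<le> 1 / \<epsilon> * (L / 4 * (N + N' + Z))"
    using pos(1) by (intro mult_left_mono) auto
  have "1 / \<epsilon> * (L / 4 * X) = L / (4 * \<epsilon>) * X" for X by simp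
  with scaled have potential:
    "1 / \<epsilon> * FI p - 1 / \<epsilon> * FI q - 1 / \<epsilon> * S \<le> L / (4 * \<epsilon>) * (N + N' + Z)"
    by (simp only: right_diff_distrib)
  define c where "c = L / (4 * \<epsilon>)"
  have half: "L / (2 * \<epsilon>) = 2 * c" by (simp add: c_def)
  have E: "E_CN \<Omega> \<epsilon> F L B \<phi> (n + 1) = \<epsilon> / 2 * ip p p + 1 / \<epsilon> * FI p + (L / (4 * \<epsilon>) + B / 2) * N"
    "E_CN \<Omega> \<epsilon> F L B \<phi> n = \<epsilon> / 2 * ip q q + 1 / \<epsilon> * FI q + (L / (4 * \<epsilon>) + B / 2) * N'"
    unfolding E_CN_def diffs p_def[symmetric] q_def[symmetric]
    by (simp_all add: energy_eq[OF \<Omega> _ pot] neu L2_norm_squared ip_def FI_def N_def N'_def)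
  have "E_CN \<Omega> \<epsilon> F L B \<phi> (n + 1) \<le> E_CN \<Omega> \<epsilon> F L B \<phi> n
           - (2 * sqrt (A / \<gamma>) - L / (2 * \<epsilon>)) * N - (B / 2 - L / (4 * \<epsilon>)) * Z"
    unfolding E half using identity interp potential
    unfolding c_def[symmetric]
    by (simp add: algebra_simps add_divide_distrib diff_divide_distrib)
  then show "E_CN \<Omega> \<epsilon> F L B \<phi> (n + 1) \<le> E_CN \<Omega> \<epsilon> F L B \<phi> n
           - (2 * sqrt (A / \<gamma>) - L / (2 * \<epsilon>)) * (L2_norm \<Omega> (dt \<phi> (n + 1)))\<^sup>2
           - (B / 2 - L / (4 * \<epsilon>)) * (L2_norm \<Omega> (dtt \<phi> (n + 1)))\<^sup>2"
    unfolding diffs L2_norm_squared real_norm_def power2_abs N_def Z_def .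
qed

end
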